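(* If $\mathcal{U}$ is a p-point on $\omega$, then $\prod_{n<\omega}\mathcal{U}\equiv_T\mathcal{U}\times\omega^\omega$, and therefore $\prod_{n<\omega}\mathcal{U}\equiv_T\mathcal{U}\cdot\mathcal{U}\cdot\mathcal{U}$.
   Context: Ultrafilters are ordered by $\supseteq$, $\omega^\omega$ by pointwise $\le$ ($h\le g$ iff $h(n)\le g(n)$ for all $n$), and products by the coordinatewise order; $\prod_{n<\omega}\mathcal{U}$ is the product of $\omega$ copies of $\mathcal{U}$. $D\le_T E$ means there is a map $E\to D$ sending cofinal subsets to cofinal subsets; $D\equiv_T E$ means $D\le_T E$ and $E\le_T D$. For ultrafilters $\mathcal{U},\mathcal{V}$ (on $\omega$, or on a countable set identified with $\omega$ via a bijection), $\mathcal{U}\cdot\mathcal{V}=\{A\subseteq\omega\times\omega:\{i:\{j:(i,j)\in A\}\in\mathcal{V}\}\in\mathcal{U}\}$, and $\mathcal{U}\cdot\mathcal{U}\cdot\mathcal{U}=\mathcal{U}\cdot(\mathcal{U}\cdot\mathcal{U})$. A p-point is a nonprincipal ultrafilter on $\omega$ in which every countable subfamily $\{X_n\}$ has some $X$ in the ultrafilter with $X\setminus X_n$ finite for all $n$. *)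

theory Defs
  imports Main "HOL-Library.FuncSet"
begin

section \<open>Tukey reducibility\<close>

text \<open>A partial order is a reflexive relation \<open>r\<close> with carrier \<^term>\<open>Field r\<close>.
  The predicate below is the usual non-strict notion; \<^const>\<open>cofinal\<close> from the cardinals
  development additionally demands a witness different from the given element.\<close>

definition cofinal_subset :: "'a rel \<Rightarrow> 'a set \<Rightarrow> bool" where
  "cofinal_subset r X \<longleftrightarrow> X \<subseteq> Field r \<and> (\<forall>a\<in>Field r. \<exists>x\<in>X. (a, x) \<in> r)"

definition tukey_le :: "'a rel \<Rightarrow> 'b rel \<Rightarrow> bool" where
  "tukey_le D E \<longleftrightarrow>
     (\<exists>f \<in> Field E \<rightarrow> Field D. \<forall>X. cofinal_subset E X \<longrightarrow> cofinal_subset D (f ` X))"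

definition tukey_equiv :: "'a rel \<Rightarrow> 'b rel \<Rightarrow> bool" where
  "tukey_equiv D E \<longleftrightarrow> tukey_le D E \<and> tukey_le E D"


section \<open>The orders involved\<close>

definition times_order :: "'a rel \<Rightarrow> 'b rel \<Rightarrow> ('a \<times> 'b) rel" where
  "times_order r s = {((a, b), (a', b')). (a, a') \<in> r \<and> (b, b') \<in> s}"

definition prod_order :: "('i \<Rightarrow> 'a rel) \<Rightarrow> ('i \<Rightarrow> 'a) rel" where
  "prod_order r = {(f, g). \<forall>i. (f i, g i) \<in> r i}"

definition baire_order :: "(nat \<Rightarrow> nat) rel" where
  "baire_order = relation_of (\<le>) UNIV"

definition uf_order :: "'a set set \<Rightarrow> 'a set rel" where
  "uf_order U = relation_of (\<supseteq>) U"

lemma Field_baire_order: "Field baire_order = UNIV"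
  by (auto simp: baire_order_def relation_of_def Field_def)

lemma Field_uf_order: "Field (uf_order U) = U"
  by (auto simp: uf_order_def relation_of_def Field_def)

lemma Field_times_order:
  assumes "Refl r" "Refl s"
  shows "Field (times_order r s) = Field r \<times> Field s"
  using assms by (fastforce simp: times_order_def Field_def refl_on_def)

lemma Field_prod_order:
  assumes "\<And>i. Refl (r i)"
  shows "Field (prod_order r) = {f. \<forall>i. f i \<in> Field (r i)}"
proof
  show "Field (prod_order r) \<subseteq> {f. \<forall>i. f i \<in> Field (r i)}"
    by (auto simp: prod_order_def Field_def)
  show "{f. \<forall>i. f i \<in> Field (r i)} \<subseteq> Field (prod_order r)"
  proof clarify
    fix f assume "\<forall>i. f i \<in> Field (r i)"
    then have "(f, f) \<in> prod_order r"
      using assms by (auto simp: prod_order_def refl_on_def)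
    then show "f \<in> Field (prod_order r)" by (rule FieldI1)
  qed
qed

lemma Partial_order_baire_order: "Partial_order baire_order"
  unfolding partial_order_on_def preorder_on_def Field_baire_order
  by (auto simp: refl_on_def trans_def antisym_def baire_order_def relation_of_def
      intro: order_trans)

lemma Partial_order_uf_order: "Partial_order (uf_order U)"
  unfolding partial_order_on_def preorder_on_def Field_uf_order
  by (auto simp: refl_on_def trans_def antisym_def uf_order_def relation_of_def)


section \<open>Ultrafilters\<close>

definition ultrafilter :: "'a set set \<Rightarrow> bool" where
  "ultrafilter U \<longleftrightarrow>
     UNIV \<in> U \<and> {} \<notin> U \<and>
     (\<forall>A B. A \<in> U \<longrightarrow> A \<subseteq> B \<longrightarrow> B \<in> U) \<and>
     (\<forall>A B. A \<in> U \<longrightarrow> B \<in> U \<longrightarrow> A \<inter> B \<in> U) \<and>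
     (\<forall>A. A \<in> U \<or> - A \<in> U)"

definition principal_uf :: "'a \<Rightarrow> 'a set set" where
  "principal_uf a = {A. a \<in> A}"

definition p_point :: "nat set set \<Rightarrow> bool" where
  "p_point U \<longleftrightarrow>
     ultrafilter U \<and> (\<forall>a. U \<noteq> principal_uf a) \<and>
     (\<forall>X :: nat \<Rightarrow> nat set. (\<forall>n. X n \<in> U) \<longrightarrow> (\<exists>Y\<in>U. \<forall>n. finite (Y - X n)))"

definition fubini :: "'a set set \<Rightarrow> 'b set set \<Rightarrow> ('a \<times> 'b) set set" where
  "fubini U V = {A. {i. {j. (i, j) \<in> A} \<in> V} \<in> U}"

lemma ultrafilter_fubini:
  assumes U: "ultrafilter U" and V: "ultrafilter V"
  shows "ultrafilter (fubini U V)"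
proof -
  have compl: "- A \<in> V \<longleftrightarrow> A \<notin> V" for A
    using V unfolding ultrafilter_def by (metis Compl_disjoint)
  have upU: "A \<in> U \<Longrightarrow> A \<subseteq> B \<Longrightarrow> B \<in> U" for A B
    using U unfolding ultrafilter_def by blast
  have upV: "A \<in> V \<Longrightarrow> A \<subseteq> B \<Longrightarrow> B \<in> V" for A B
    using V unfolding ultrafilter_def by blast
  have intU: "A \<in> U \<Longrightarrow> B \<in> U \<Longrightarrow> A \<inter> B \<in> U" for A B
    using U unfolding ultrafilter_def by blast
  have intV: "A \<in> V \<Longrightarrow> B \<in> V \<Longrightarrow> A \<inter> B \<in> V" for A B
    using V unfolding ultrafilter_def by blast
  have "A \<inter> B \<in> fubini U V" if "A \<in> fubini U V" "B \<in> fubini U V" for A B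
  proof -
    have "{i. {j. (i, j) \<in> A} \<in> V} \<inter> {i. {j. (i, j) \<in> B} \<in> V}
            \<subseteq> {i. {j. (i, j) \<in> A \<inter> B} \<in> V}"
      using intV by (auto simp: Collect_conj_eq)
    then show ?thesis
      using that intU upU unfolding fubini_def by blast
  qed
  moreover have "B \<in> fubini U V" if "A \<in> fubini U V" "A \<subseteq> B" for A B
  proof -
    have "{i. {j. (i, j) \<in> A} \<in> V} \<subseteq> {i. {j. (i, j) \<in> B} \<in> V}"
      using that(2) by (auto intro: upV)
    then show ?thesis
      using that upU unfolding fubini_def by blast
  qed
  moreover have "A \<in> fubini U V \<or> - A \<in> fubini U V" for A
  proof -
    have "{j. (i, j) \<in> - A} = - {j. (i, j) \<in> A}" for i by auto
    then have "{i. {j. (i, j) \<in> - A} \<in> V} = - {i. {j. (i, j) \<in> A} \<in> V}"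
      using compl by auto
    then show ?thesis
      using U unfolding fubini_def ultrafilter_def by auto
  qed
  moreover have "UNIV \<in> fubini U V" "{} \<notin> fubini U V"
    using U V by (auto simp: fubini_def ultrafilter_def)
  ultimately show ?thesis unfolding ultrafilter_def by blast
qed

end

(*
  All reductions are monotone maps with cofinal range.

  From U \<times> \<omega>^\<omega> to the power of U, send (A, g) to the sequence A - {..<g n}; the range is cofinal
  because every sequence in a p-point has a pseudo-intersection in it. Back, send (X_n) to
  (X_0, n \<mapsto> min X_n).

  The triple product is below the power of U because a set in it is determined, up to shrinking, by
  countably many members of U. It is above U via the projection, and above \<omega>^\<omega> because
  A \<mapsto> (n \<mapsto> least second coordinate of a point of A with first coordinate at least n)
  dominates every nondecreasing g as soon as A is contained in {(i, j, k). g i \<le> j}.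
*)

theory Submission
  imports Defs "HOL-Library.Countable"
begin

section \<open>Monotone cofinal maps\<close>

text \<open>Given \<open>d\<close>, pick \<open>e\<close> with \<open>f e\<close> above
  \<open>d\<close>, then a member \<open>x\<close> of the cofinal set above \<open>e\<close>;
  monotonicity puts \<open>f x\<close> above \<open>f e\<close>, hence above \<open>d\<close>. Every
  concrete reduction below is obtained from this criterion.\<close>

lemma tukey_leI:
  assumes "trans D"
    and Field: "\<And>e. e \<in> Field E \<Longrightarrow> f e \<in> Field D"
    and mono: "\<And>a b. (a, b) \<in> E \<Longrightarrow> (f a, f b) \<in> D"
    and cofinal: "\<And>d. d \<in> Field D \<Longrightarrow> \<exists>e\<in>Field E. (d, f e) \<in> D"
  shows "tukey_le D E"
  unfolding tukey_le_def
proof (intro bexI allI impI)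
  show "f \<in> Field E \<rightarrow> Field D"
    using Field by blast
  fix X assume X: "cofinal_subset E X"
  show "cofinal_subset D (f ` X)"
    unfolding cofinal_subset_def
  proof (intro conjI ballI)
    show "f ` X \<subseteq> Field D"
      using X Field by (auto simp: cofinal_subset_def)
    fix d assume "d \<in> Field D"
    then obtain e where e: "e \<in> Field E" "(d, f e) \<in> D"
      using cofinal by blast
    then obtain x where "x \<in> X" "(e, x) \<in> E"
      using X by (auto simp: cofinal_subset_def)
    then show "\<exists>y\<in>f ` X. (d, y) \<in> D"
      using e mono \<open>trans D\<close> by (blast dest: transD)
  qed
qed

lemma tukey_le_trans:
  assumes "tukey_le D E" "tukey_le E F"
  shows "tukey_le D F"
proof -
  obtain f where f: "f \<in> Field E \<rightarrow> Field D"
      "\<And>X. cofinal_subset E X \<Longrightarrow> cofinal_subset D (f ` X)"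
    using assms(1) unfolding tukey_le_def by blast
  obtain g where g: "g \<in> Field F \<rightarrow> Field E"
      "\<And>X. cofinal_subset F X \<Longrightarrow> cofinal_subset E (g ` X)"
    using assms(2) unfolding tukey_le_def by blast
  show ?thesis
    unfolding tukey_le_def
  proof (intro bexI allI impI)
    show "f \<circ> g \<in> Field F \<rightarrow> Field D"
      using f(1) g(1) by auto
    show "cofinal_subset D ((f \<circ> g) ` X)" if "cofinal_subset F X" for X
      using f(2)[OF g(2)[OF that]] by (simp add: image_comp)
  qed
qed

section \<open>The orders unfolded, their fields and transitivity\<close>

lemma uf_order_iff: "(A, B) \<in> uf_order U \<longleftrightarrow> A \<in> U \<and> B \<in> U \<and> B \<subseteq> A"
  by (auto simp: uf_order_def relation_of_def)

lemma baire_order_iff: "(f, g) \<in> baire_order \<longleftrightarrow> (\<forall>n. f n \<le> g n)"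
  by (auto simp: baire_order_def relation_of_def le_fun_def)

lemma prod_uf_order_iff:
  "(f, g) \<in> prod_order (\<lambda>i. uf_order U) \<longleftrightarrow> (\<forall>i. f i \<in> U \<and> g i \<in> U \<and> g i \<subseteq> f i)"
  by (auto simp: prod_order_def uf_order_iff)

lemma times_uf_baire_order_iff:
  "((A, f), (B, g)) \<in> times_order (uf_order U) baire_order \<longleftrightarrow>
     A \<in> U \<and> B \<in> U \<and> B \<subseteq> A \<and> (\<forall>n. f n \<le> g n)"
  by (auto simp: times_order_def uf_order_iff baire_order_iff)

lemma Refl_uf_order: "Refl (uf_order U)"
  using Partial_order_uf_order by (blast dest: partial_order_onD(1))

lemma Refl_baire_order: "Refl baire_order"
  using Partial_order_baire_order by (rule partial_order_onD(1))

lemma Field_prod_uf_order: "Field (prod_order (\<lambda>i. uf_order U)) = {f. \<forall>i. f i \<in> U}"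
  using Field_prod_order[OF Refl_uf_order] by (simp add: Field_uf_order)

lemma Field_times_uf_baire_order: "Field (times_order (uf_order U) baire_order) = U \<times> UNIV"
  using Field_times_order[OF Refl_uf_order Refl_baire_order]
  by (simp add: Field_uf_order Field_baire_order)

lemma trans_uf_order: "trans (uf_order U)"
  using Partial_order_uf_order by (blast dest: partial_order_onD(2))

lemma trans_baire_order: "trans baire_order"
  using Partial_order_baire_order by (rule partial_order_onD(2))

lemma trans_prod_order: "(\<And>i. trans (r i)) \<Longrightarrow> trans (prod_order r)"
  unfolding trans_def prod_order_def by blast

lemma trans_times_order: "trans r \<Longrightarrow> trans s \<Longrightarrow> trans (times_order r s)"
  unfolding trans_def times_order_def by blast


section \<open>Ultrafilters\<close>

lemma ultrafilter_UNIV: "ultrafilter U \<Longrightarrow> UNIV \<in> U"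
  and ultrafilter_empty: "ultrafilter U \<Longrightarrow> {} \<notin> U"
  and ultrafilter_mono: "ultrafilter U \<Longrightarrow> A \<in> U \<Longrightarrow> A \<subseteq> B \<Longrightarrow> B \<in> U"
  and ultrafilter_Int: "ultrafilter U \<Longrightarrow> A \<in> U \<Longrightarrow> B \<in> U \<Longrightarrow> A \<inter> B \<in> U"
  and ultrafilter_Compl: "ultrafilter U \<Longrightarrow> A \<notin> U \<Longrightarrow> - A \<in> U"
  unfolding ultrafilter_def by blast+

text \<open>A singleton \<open>{x}\<close> in \<open>U\<close> would force \<open>U\<close> to be
  the principal ultrafilter at \<open>x\<close>. So the complement of each point lies in
  \<open>U\<close>, and finitely many of these are intersected.\<close>

lemma ultrafilter_nonprincipal_cofinite:
  assumes U: "ultrafilter U" and nonprincipal: "\<And>a. U \<noteq> principal_uf a"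
    and "finite F"
  shows "- F \<in> U"
  using \<open>finite F\<close>
proof induction
  case empty
  then show ?case
    using ultrafilter_UNIV[OF U] by simp
next
  case (insert x F)
  have "{x} \<notin> U"
  proof
    assume x: "{x} \<in> U"
    have "A \<in> U \<longleftrightarrow> x \<in> A" for A
    proof
      assume "A \<in> U"
      then have "{x} \<inter> A \<in> U"
        using U x ultrafilter_Int by blast
      then show "x \<in> A"
        using ultrafilter_empty[OF U] by (cases "x \<in> A") auto
    qed (use U x ultrafilter_mono in blast)
    then show False
      using nonprincipal[of x] by (auto simp: principal_uf_def)
  qed
  then have "- {x} \<inter> - F \<in> U"
    using U insert.IH ultrafilter_Compl ultrafilter_Int by blast
  then show ?case
    by (metis Compl_Un insert_is_Un)
qed

lemma p_point_ultrafilter: "p_point U \<Longrightarrow> ultrafilter U"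
  by (simp add: p_point_def)

lemma p_point_atLeast:
  assumes "p_point U"
  shows "{n..} \<in> U"
proof -
  have "- {..<n} \<in> U"
    using assms by (intro ultrafilter_nonprincipal_cofinite) (auto simp: p_point_def)
  then show ?thesis
    by simp
qed

lemma p_point_diff_lessThan:
  assumes "p_point U" "A \<in> U"
  shows "A - {..<n} \<in> U"
proof -
  have "A - {..<n} = A \<inter> {n..}"
    by auto
  then show ?thesis
    using assms p_point_ultrafilter p_point_atLeast ultrafilter_Int by metis
qed

lemma fubini_iff: "A \<in> fubini U V \<longleftrightarrow> {i. {j. (i, j) \<in> A} \<in> V} \<in> U"
  by (simp add: fubini_def)


section \<open>The power of a p-point\<close>

lemma tukey_le_times_prod:
  assumes U: "p_point U"
  shows "tukey_le (times_order (uf_order U) baire_order) (prod_order (\<lambda>n::nat. uf_order U))"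
proof (rule tukey_leI[where f = "\<lambda>X. (X 0, \<lambda>n. LEAST k. k \<in> X n)"])
  show "trans (times_order (uf_order U) baire_order)"
    by (intro trans_times_order trans_uf_order trans_baire_order)
next
  fix X assume "X \<in> Field (prod_order (\<lambda>n::nat. uf_order U))"
  then show "(X 0, \<lambda>n. LEAST k. k \<in> X n) \<in> Field (times_order (uf_order U) baire_order)"
    by (simp add: Field_prod_uf_order Field_times_uf_baire_order)
next
  fix X Y assume XY: "(X, Y) \<in> prod_order (\<lambda>n::nat. uf_order U)"
  have "(LEAST k. k \<in> X n) \<le> (LEAST k. k \<in> Y n)" for n
  proof (rule Least_le)
    \<comment> \<open>\<open>LEAST\<close> is a genuine minimum only on a nonempty set; that no
      member of \<open>U\<close> is empty makes the minimum grow as the set shrinks.\<close>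
    have "Y n \<noteq> {}"
      using XY ultrafilter_empty[OF p_point_ultrafilter[OF U]] by (metis prod_uf_order_iff)
    then have "(LEAST k. k \<in> Y n) \<in> Y n"
      by (auto intro: LeastI)
    then show "(LEAST k. k \<in> Y n) \<in> X n"
      using XY by (auto simp: prod_uf_order_iff)
  qed
  then show "((X 0, \<lambda>n. LEAST k. k \<in> X n), (Y 0, \<lambda>n. LEAST k. k \<in> Y n))
      \<in> times_order (uf_order U) baire_order"
    using XY by (auto simp: prod_uf_order_iff times_uf_baire_order_iff)
next
  fix d assume "d \<in> Field (times_order (uf_order U) baire_order)"
  then obtain A g where d: "d = (A, g)" "A \<in> U"
    by (auto simp: Field_times_uf_baire_order)
  \<comment> \<open>These sets form the witness: the one at index 0 is contained in
    \<open>A\<close>, and the minimum of the one at index \<open>n\<close> is at least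
    \<open>g n\<close>.\<close>
  have in_U: "A - {..<g n} \<in> U" for n
    using p_point_diff_lessThan[OF U d(2)] .
  have "g n \<le> (LEAST k. k \<in> A - {..<g n})" for n
  proof -
    have "A - {..<g n} \<noteq> {}"
      using in_U[of n] ultrafilter_empty[OF p_point_ultrafilter[OF U]] by metis
    then have "(LEAST k. k \<in> A - {..<g n}) \<in> A - {..<g n}"
      by (meson LeastI ex_in_conv)
    then show ?thesis
      by simp
  qed
  then show "\<exists>X\<in>Field (prod_order (\<lambda>n::nat. uf_order U)).
      (d, (X 0, \<lambda>n. LEAST k. k \<in> X n)) \<in> times_order (uf_order U) baire_order"
    using d in_U
    by (intro bexI[of _ "\<lambda>n. A - {..<g n}"])
      (auto simp: times_uf_baire_order_iff Field_prod_uf_order)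
qed

lemma tukey_le_prod_times:
  assumes U: "p_point U"
  shows "tukey_le (prod_order (\<lambda>n::nat. uf_order U)) (times_order (uf_order U) baire_order)"
proof (rule tukey_leI[where f = "\<lambda>(A, g) n. A - {..<g n}"])
  show "trans (prod_order (\<lambda>n::nat. uf_order U))"
    by (intro trans_prod_order trans_uf_order)
next
  fix e assume "e \<in> Field (times_order (uf_order U) baire_order)"
  then show "(case e of (A, g) \<Rightarrow> \<lambda>n. A - {..<g n}) \<in> Field (prod_order (\<lambda>n::nat. uf_order U))"
    using p_point_diff_lessThan[OF U]
    by (auto simp: Field_prod_uf_order Field_times_uf_baire_order)
next
  fix a b assume ab: "(a, b) \<in> times_order (uf_order U) baire_order"
  obtain A g B h where eq: "a = (A, g)" "b = (B, h)"
    by (cases a; cases b)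
  have AB: "A \<in> U" "B \<in> U" "B \<subseteq> A" and "g n \<le> h n" for n
    using ab by (auto simp: eq times_uf_baire_order_iff)
  then have "B - {..<h n} \<subseteq> A - {..<g n}" for n
    by (intro Diff_mono) auto
  then show "(case a of (A, g) \<Rightarrow> \<lambda>n. A - {..<g n}, case b of (A, g) \<Rightarrow> \<lambda>n. A - {..<g n})
      \<in> prod_order (\<lambda>n::nat. uf_order U)"
    using AB p_point_diff_lessThan[OF U] by (simp add: eq prod_uf_order_iff)
next
  fix X assume "X \<in> Field (prod_order (\<lambda>n::nat. uf_order U))"
  then have X: "X n \<in> U" for n
    by (simp add: Field_prod_uf_order)
  \<comment> \<open>The p-point property gives one set almost contained in all \<open>X n\<close>.
    Each finite error is bounded by some \<open>g n\<close>, so cutting \<open>Y\<close> at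
    \<open>g n\<close> lands inside \<open>X n\<close>.\<close>
  then obtain Y where Y: "Y \<in> U" "\<And>n. finite (Y - X n)"
    using U unfolding p_point_def by blast
  then have "\<exists>m. Y - X n \<subseteq> {..<m}" for n
    by (simp add: subset_eq flip: finite_nat_set_iff_bounded)
  then obtain g where "Y - X n \<subseteq> {..<g n}" for n
    by metis
  then have "Y - {..<g n} \<subseteq> X n" for n
    by blast
  then show "\<exists>e\<in>Field (times_order (uf_order U) baire_order).
      (X, case e of (A, g) \<Rightarrow> \<lambda>n. A - {..<g n}) \<in> prod_order (\<lambda>n::nat. uf_order U)"
    using X Y(1) p_point_diff_lessThan[OF U Y(1)]
    by (intro bexI[of _ "(Y, g)"]) (auto simp: prod_uf_order_iff Field_times_uf_baire_order)
qed


section \<open>Fubini products\<close>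

lemma tukey_le_fubini3_prod:
  fixes U :: "'a::countable set set"
  assumes U: "ultrafilter U"
  shows "tukey_le (uf_order (fubini U (fubini U U))) (prod_order (\<lambda>n::nat. uf_order U))"
proof -
  \<comment> \<open>The sequence is read as a tree whose nodes are finite lists coded by
    \<open>to_nat\<close>: the set at \<open>[]\<close> restricts the first coordinate, the one at
    \<open>[i]\<close> the second, the one at \<open>[i, j]\<close> the third.\<close>
  define f :: "(nat \<Rightarrow> 'a set) \<Rightarrow> ('a \<times> 'a \<times> 'a) set" where
    "f X = {(i, j, k). i \<in> X (to_nat ([] :: 'a list)) \<and> j \<in> X (to_nat [i]) \<and> k \<in> X (to_nat [i, j])}"
    for X
  have f_in: "f X \<in> fubini U (fubini U U)" if X: "\<And>n. X n \<in> U" for X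
    unfolding fubini_iff mem_Collect_eq
  proof (rule ultrafilter_mono[OF U X], rule subsetI, unfold mem_Collect_eq)
    fix i assume i: "i \<in> X (to_nat ([] :: 'a list))"
    show "{j. {k. (i, j, k) \<in> f X} \<in> U} \<in> U"
      by (rule ultrafilter_mono[OF U X[of "to_nat [i]"]]) (auto simp: f_def i X)
  qed
  show ?thesis
  proof (rule tukey_leI[where f = f])
    show "trans (uf_order (fubini U (fubini U U)))"
      by (rule trans_uf_order)
  next
    fix X assume "X \<in> Field (prod_order (\<lambda>n::nat. uf_order U))"
    then show "f X \<in> Field (uf_order (fubini U (fubini U U)))"
      by (simp add: Field_prod_uf_order Field_uf_order f_in)
  next
    fix X Y assume XY: "(X, Y) \<in> prod_order (\<lambda>n::nat. uf_order U)"
    then have "f Y \<subseteq> f X"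
      by (auto simp: prod_uf_order_iff f_def)
    then show "(f X, f Y) \<in> uf_order (fubini U (fubini U U))"
      using XY by (simp add: prod_uf_order_iff uf_order_iff f_in)
  next
    fix A assume "A \<in> Field (uf_order (fubini U (fubini U U)))"
    then have A: "A \<in> fubini U (fubini U U)"
      by (simp add: Field_uf_order)
    define B where "B i = {j. {k. (i, j, k) \<in> A} \<in> U}" for i
    \<comment> \<open>The branching set of \<open>A\<close> at the node \<open>l\<close>. Only lists
      of length at most 2 are read by \<open>f\<close>, so the value at longer ones is
      immaterial.\<close>
    define S where "S l = (case l of [] \<Rightarrow> {i. B i \<in> U} | [i] \<Rightarrow> B i
      | i # j # _ \<Rightarrow> {k. (i, j, k) \<in> A})" for l
    \<comment> \<open>The default \<open>UNIV\<close> keeps every entry in \<open>U\<close>. It is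
      never met on the way to a point of \<open>f X\<close>: \<open>S []\<close> is in
      \<open>U\<close>, \<open>i\<close> in \<open>S []\<close> says that \<open>S [i]\<close> is in
      \<open>U\<close>, and \<open>j\<close> in \<open>S [i]\<close> says that
      \<open>S [i, j]\<close> is in \<open>U\<close>.\<close>
    define X where "X n = (let s = S (from_nat n) in if s \<in> U then s else UNIV)" for n
    have X_in: "X n \<in> U" for n
      by (simp add: X_def Let_def ultrafilter_UNIV[OF U])
    have X_eq: "X (to_nat l) = S l" if "S l \<in> U" for l
      using that by (simp add: X_def)
    have "S [] \<in> U"
      using A by (simp add: S_def B_def fubini_iff)
    then have "f X \<subseteq> A"
      using X_eq by (auto simp: f_def S_def B_def)
    then show "\<exists>X\<in>Field (prod_order (\<lambda>n::nat. uf_order U)).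
        (A, f X) \<in> uf_order (fubini U (fubini U U))"
      using A X_in by (intro bexI[of _ X]) (auto simp: uf_order_iff f_in Field_prod_uf_order)
  qed
qed

text \<open>The assumption on \<open>c\<close> says that it tends to infinity along
  \<open>V\<close>, so it can record values of arbitrary functions. For the triple product,
  \<open>V\<close> is the square of \<open>U\<close> and \<open>c\<close> the first
  projection.\<close>

lemma tukey_le_times_fubini:
  fixes c :: "'b \<Rightarrow> nat"
  assumes U: "p_point U" and V: "ultrafilter V" and c: "\<And>m. {b. m \<le> c b} \<in> V"
  shows "tukey_le (times_order (uf_order U) baire_order) (uf_order (fubini U V))"
proof -
  \<comment> \<open>\<open>P A\<close> keeps only the indices with a \<open>V\<close>-large fibre,
    so it lies in \<open>U\<close> exactly when \<open>A\<close> lies in the product. It therefore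
    meets every tail, which makes each \<open>C A n\<close> nonempty and its minimum
    meaningful.\<close>
  define P :: "(nat \<times> 'b) set \<Rightarrow> nat set" where "P A = {i. {b. (i, b) \<in> A} \<in> V}" for A
  define C :: "(nat \<times> 'b) set \<Rightarrow> nat \<Rightarrow> nat set" where
    "C A n = {c b |i b. n \<le> i \<and> (i, b) \<in> A}" for A n
  have C_nonempty: "C A n \<noteq> {}" if "A \<in> fubini U V" for A n
  proof -
    have "P A - {..<n} \<in> U"
      using that p_point_diff_lessThan[OF U] by (simp add: fubini_iff P_def)
    then have "P A - {..<n} \<noteq> {}"
      using ultrafilter_empty[OF p_point_ultrafilter[OF U]] by metis
    then obtain i where "i \<in> P A" "n \<le> i"
      by fastforce
    then have "{b. (i, b) \<in> A} \<noteq> {}"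
      using ultrafilter_empty[OF V] by (metis P_def mem_Collect_eq)
    then obtain b where "(i, b) \<in> A"
      by blast
    with \<open>n \<le> i\<close> show ?thesis
      by (auto simp: C_def)
  qed
  show ?thesis
  proof (rule tukey_leI[where f = "\<lambda>A. (P A, \<lambda>n. LEAST m. m \<in> C A n)"])
    show "trans (times_order (uf_order U) baire_order)"
      by (intro trans_times_order trans_uf_order trans_baire_order)
  next
    fix A assume "A \<in> Field (uf_order (fubini U V))"
    then show "(P A, \<lambda>n. LEAST m. m \<in> C A n) \<in> Field (times_order (uf_order U) baire_order)"
      by (simp add: Field_times_uf_baire_order Field_uf_order P_def fubini_iff)
  next
    fix A B assume "(A, B) \<in> uf_order (fubini U V)"
    then have AB: "A \<in> fubini U V" "B \<in> fubini U V" "B \<subseteq> A"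
      by (auto simp: uf_order_iff)
    have "P B \<subseteq> P A"
      using AB(3) by (auto simp: P_def elim!: ultrafilter_mono[OF V])
    moreover have "(LEAST m. m \<in> C A n) \<le> (LEAST m. m \<in> C B n)" for n
    proof (rule Least_le)
      have "(LEAST m. m \<in> C B n) \<in> C B n"
        using C_nonempty[OF AB(2), of n] by (meson LeastI ex_in_conv)
      then show "(LEAST m. m \<in> C B n) \<in> C A n"
        using AB(3) by (auto simp: C_def)
    qed
    ultimately show "((P A, \<lambda>n. LEAST m. m \<in> C A n), (P B, \<lambda>n. LEAST m. m \<in> C B n))
        \<in> times_order (uf_order U) baire_order"
      using AB by (simp add: times_uf_baire_order_iff P_def fubini_iff)
  next
    fix d assume "d \<in> Field (times_order (uf_order U) baire_order)"
    then obtain A g where d: "d = (A, g)" "A \<in> U"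
      by (auto simp: Field_times_uf_baire_order)
    \<comment> \<open>Bounding \<open>c b\<close> by all \<open>g n\<close> with
      \<open>n \<le> i\<close>, not just by \<open>g i\<close>, handles a \<open>g\<close> that is
      not monotone: any point with first coordinate at least \<open>n\<close> then has
      \<open>c\<close>-value at least \<open>g n\<close>.\<close>
    define B where "B = {(i, b). i \<in> A \<and> (\<forall>n\<le>i. g n \<le> c b)}"
    have PB: "P B = A"
    proof
      show "P B \<subseteq> A"
      proof
        fix i assume "i \<in> P B"
        then have "{b. (i, b) \<in> B} \<noteq> {}"
          using ultrafilter_empty[OF V] by (metis P_def mem_Collect_eq)
        then show "i \<in> A"
          by (auto simp: B_def)
      qed
      show "A \<subseteq> P B"
      proof
        fix i assume "i \<in> A"
        \<comment> \<open>Only finitely many bounds are imposed over a fixed \<open>i\<close>, so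
          their maximum reduces them to one instance of the assumption on \<open>c\<close>.\<close>
        moreover have "{b. Max (g ` {..i}) \<le> c b} \<subseteq> {b. \<forall>n\<le>i. g n \<le> c b}"
          by auto
        ultimately show "i \<in> P B"
          using ultrafilter_mono[OF V c[of "Max (g ` {..i})"]] by (simp add: P_def B_def)
      qed
    qed
    then have B_in: "B \<in> fubini U V"
      using d(2) by (simp add: fubini_iff P_def)
    have "g n \<le> (LEAST m. m \<in> C B n)" for n
    proof -
      have "(LEAST m. m \<in> C B n) \<in> C B n"
        using C_nonempty[OF B_in, of n] by (meson LeastI ex_in_conv)
      then show ?thesis
        by (auto simp: C_def B_def)
    qed
    then show "\<exists>B\<in>Field (uf_order (fubini U V)).
        (d, (P B, \<lambda>n. LEAST m. m \<in> C B n)) \<in> times_order (uf_order U) baire_order"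
      using d B_in PB by (intro bexI[of _ B]) (auto simp: times_uf_baire_order_iff Field_uf_order)
  qed
qed

theorem theorem33:
  fixes U :: "nat set set"
  assumes "p_point U"
  shows "tukey_equiv (prod_order (\<lambda>n::nat. uf_order U)) (times_order (uf_order U) baire_order)
       \<and> tukey_equiv (prod_order (\<lambda>n::nat. uf_order U)) (uf_order (fubini U (fubini U U)))"
proof -
  have U: "ultrafilter U"
    by (rule p_point_ultrafilter[OF assms])
  \<comment> \<open>On the inner pair, \<open>fst\<close> reads the middle coordinate of a
    triple.\<close>
  have "{b. m \<le> fst b} \<in> fubini U U" for m :: nat
  proof -
    have "{m..} \<subseteq> {i. {j::nat. m \<le> i} \<in> U}"
      by (auto simp: ultrafilter_UNIV[OF U])
    then show ?thesis
      using ultrafilter_mono[OF U p_point_atLeast[OF assms]] by (simp add: fubini_iff)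
  qed
  then have "tukey_le (times_order (uf_order U) baire_order) (uf_order (fubini U (fubini U U)))"
    by (rule tukey_le_times_fubini[OF assms ultrafilter_fubini[OF U U]])
  \<comment> \<open>The power is below \<open>U \<times> \<omega>^\<omega>\<close>, which is below
    the triple product, which is below the power; transitivity closes the cycle.\<close>
  then show ?thesis
    using tukey_le_prod_times[OF assms] tukey_le_times_prod[OF assms] tukey_le_fubini3_prod[OF U]
      tukey_le_trans
    unfolding tukey_equiv_def by blast
qed

end
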